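(* For each $N$ let $(Z_n)_{n\ge0}$ be the exploration Markov chain on $\{0,\dots,N\}$ described in the context, and let $T^*_N=\inf\{n\ge1:Z_n=N\}$ (the final number of active vertices). Suppose there are a Lipschitz continuous function $\gamma:[0,\infty)\to\mathbb{R}$ and numbers $\delta_N$ such that $\sup_{0\le x\le N-1}|\gamma_N(x)-\gamma(x/N)|\le\delta_N$ for all $N$. Let $z$ be the solution of $\dot z(t)=1+\gamma(z(t))$, $z(0)=0$, and let $T^*$ be the time with $z(T^* )=1$. If $\delta_N\to0$, $\bar\gamma_N=o(N)$ and $\bar\psi_N=o(N)$ as $N\to\infty$, then $T^*_N/N$ converges to $T^*$ in $L^1$.
   Context: Exploration process: in a random graph on $N$ vertices, no vertex is initially explored; at each step one unexplored vertex is selected (becomes active), and it and all its unexplored neighbours become explored. $Z_n$ is the number of explored vertices after $n$ steps. Standing homogeneity assumption: the conditional law of the number of unexplored neighbours of the vertex selected at step $n$ depends on the past only through $Z_{n-1}$. Thus for each $N$ and each $x\in\{0,\dots,N-1\}$ there is a probability distribution $p_N(\cdot,x)$ on $\{0,\dots,N-x-1\}$ such that $(Z_n)$ is a Markov chain with $Z_0=0$, $$\mathbb{P}[Z_n=x+1+k\mid Z_{n-1}=x]=p_N(k,x)\quad (0\le x<N,\ k\ge 0),$$ and $N$ is absorbing. Write $$\gamma_N(x)=\sum_{k}k\,p_N(k,x),\quad \psi_N(x)=\sum_k(k-\gamma_N(x))^2p_N(k,x),\quad \bar\gamma_N=\sup_x\gamma_N(x),\quad \bar\psi_N=\sup_x\psi_N(x).$$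 *)

theory Defs
  imports "HOL-Probability.Probability" "HOL-Library.Landau_Symbols"
begin

text \<open>
  The family \<open>p N x :: nat pmf\<close> encodes the laws \<open>p\<^sub>N(\<cdot>, x)\<close>, i.e. \<open>p\<^sub>N(k, x) = pmf (p N x) k\<close>.
  Only the values with \<open>x < N\<close> carry meaning.
\<close>

definition drift :: "(nat \<Rightarrow> nat \<Rightarrow> nat pmf) \<Rightarrow> nat \<Rightarrow> nat \<Rightarrow> real" where
  "drift p N x = measure_pmf.expectation (p N x) (\<lambda>k. real k)"

definition dispersion :: "(nat \<Rightarrow> nat \<Rightarrow> nat pmf) \<Rightarrow> nat \<Rightarrow> nat \<Rightarrow> real" where
  "dispersion p N x = measure_pmf.expectation (p N x) (\<lambda>k. (real k - drift p N x)\<^sup>2)"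

text \<open>
  For \<open>N > 0\<close> the two suprema range over a finite nonempty set; the values at \<open>N = 0\<close> are irrelevant.
\<close>

definition max_drift :: "(nat \<Rightarrow> nat \<Rightarrow> nat pmf) \<Rightarrow> nat \<Rightarrow> real" where
  "max_drift p N = (SUP x\<in>{..<N}. drift p N x)"

definition max_dispersion :: "(nat \<Rightarrow> nat \<Rightarrow> nat pmf) \<Rightarrow> nat \<Rightarrow> real" where
  "max_dispersion p N = (SUP x\<in>{..<N}. dispersion p N x)"

text \<open>From a state \<open>x < N\<close> the chain jumps to \<open>x + 1 + k\<close> with probability \<open>q x k\<close>; \<open>N\<close> is absorbing.\<close>

definition exploration_kernel :: "nat \<Rightarrow> (nat \<Rightarrow> nat pmf) \<Rightarrow> nat \<Rightarrow> nat pmf" where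
  "exploration_kernel N q x =
     (if x < N then map_pmf (\<lambda>k. x + 1 + k) (q x) else return_pmf x)"

text \<open>
  The assumption \<open>markov\<close> combines the Markov property (with respect to the natural filtration) and
  the transition probabilities. Together with \<open>start\<close> and \<open>support\<close> it forces every \<open>Z n\<close> to take
  values in \<open>{0..N}\<close> almost surely.
\<close>

locale exploration_chain = prob_space M
  for M :: "'a measure" and N :: nat and q :: "nat \<Rightarrow> nat pmf" and Z :: "nat \<Rightarrow> 'a \<Rightarrow> nat" +
  assumes support: "\<And>x. x < N \<Longrightarrow> set_pmf (q x) \<subseteq> {0..N - x - 1}"
    and Z_measurable: "\<And>n. Z n \<in> measurable M (count_space UNIV)"
    and start: "AE \<omega> in M. Z 0 \<omega> = 0"
    and markov: "\<And>n s y. \<P>(\<omega> in M. \<forall>i\<le>n. Z i \<omega> = s i) > 0 \<Longrightarrow>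
      \<P>(\<omega> in M. Z (Suc n) \<omega> = y \<bar> \<forall>i\<le>n. Z i \<omega> = s i) = pmf (exploration_kernel N q (s n)) y"

text \<open>The infimum is taken in \<open>enat\<close>, so that it is \<open>\<infinity>\<close> if \<open>N\<close> is never reached.\<close>

definition final_active :: "nat \<Rightarrow> (nat \<Rightarrow> 'a \<Rightarrow> nat) \<Rightarrow> 'a \<Rightarrow> enat" where
  "final_active N Z \<omega> = (INF n\<in>{n. 1 \<le> n \<and> Z n \<omega> = N}. enat n)"

end

theory Submission
  imports Defs
begin

text \<open>
  Let \<open>G x = \<integral>\<^sub>0\<^sup>x du / (1 + \<gamma> u)\<close> be the time at which the solution \<open>z\<close> reaches \<open>x\<close>, so that \<open>G 1 = T*\<close>,
  and put \<open>V\<^sub>n = min n T*\<^sub>N / N - G (Z\<^sub>n / N)\<close>. Then \<open>V\<^sub>0 = 0\<close> and \<open>V\<^sub>N = T*\<^sub>N / N - T*\<close>. An increment of \<open>V\<close> has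
  conditional mean \<open>O(\<delta>\<^sub>N / N + S / N\<^sup>2)\<close> and conditional second moment at most \<open>S / N\<^sup>2\<close>, where \<open>S\<close> bounds
  the second moment of a jump of \<open>Z\<close> and is \<open>o(N)\<close>. As \<open>\<bar>V\<bar> \<le> 1\<close>, adding up \<open>N\<close> steps gives
  \<open>E V\<^sub>N\<^sup>2 = O(\<delta>\<^sub>N + S / N)\<close>, that is, convergence even in \<open>L\<^sup>2\<close>.
\<close>

section \<open>The limiting differential equation and its hitting times\<close>

text \<open>A solution above \<open>c\<close> would have to come down to \<open>c\<close> by time
  \<open>T\<close>, but its derivative at the moment of arrival is \<open>f c > 0\<close>. With
  \<open>c = 1\<close> this confines \<open>z\<close> to the interval on which
  \<open>\<gamma>\<close> is known to be nonnegative.\<close>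

lemma ode_le_until_hit:
  fixes z f :: "real \<Rightarrow> real"
  assumes ode: "\<And>t. t \<ge> 0 \<Longrightarrow> (z has_real_derivative f (z t)) (at t within {0..})"
    and pos: "f c > 0" and hit: "z T = c" and t: "0 \<le> t" "t \<le> T"
  shows "z t \<le> c"
proof (rule ccontr)
  assume "\<not> z t \<le> c"
  then have zt: "z t > c" by simp
  have cont: "continuous_on {t..T} z"
    by (rule continuous_on_subset[OF DERIV_continuous_on[OF ode]]) (use t in auto)
  \<comment> \<open>\<open>Inf A\<close> is the first time from \<open>t\<close> on at which
    \<open>z\<close> is at most \<open>c\<close>; the time \<open>T\<close> shows that there is
    one.\<close>
  define A where "A = {s \<in> {t..T}. z s \<le> c}"
  have "closed A"
    unfolding A_def by (intro continuous_on_closed_Collect_le cont continuous_intros)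
  moreover have "A \<noteq> {}" using t hit by (auto simp: A_def)
  moreover have bdd: "bdd_below A" by (auto simp: A_def)
  ultimately have r: "Inf A \<in> A" by (intro closed_contains_Inf)
  define r where "r = Inf A"
  have before: "z s > c" if "t \<le> s" "s < r" for s
    using cInf_lower[OF _ bdd, of s] that r by (force simp: A_def r_def)
  have rA: "t \<le> r" "r \<le> T" "z r \<le> c" using r by (auto simp: A_def r_def)
  have tr: "t < r" using rA zt by (cases "t = r") auto
  have "z r = c"
  proof (rule antisym)
    show "c \<le> z r"
    proof (rule ccontr)
      assume "\<not> c \<le> z r"
      \<comment> \<open>A value below \<open>c\<close> at time \<open>r\<close> would be preceded by
        a time \<open>s < r\<close> with a value midway between \<open>z r\<close> and
        \<open>c\<close>, hence already below \<open>c\<close>.\<close>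
      then obtain s where s: "t \<le> s" "s \<le> r" "z s = (z r + c) / 2"
        using IVT2'[of z r "(z r + c) / 2" t] zt tr rA
          continuous_on_subset[OF cont, of "{t..r}"] by auto
      have "s \<noteq> r" using s \<open>\<not> c \<le> z r\<close> by auto
      then show False using before[of s] s \<open>\<not> c \<le> z r\<close> by (simp add: field_simps)
    qed
  qed (use rA in simp)
  then have "(z has_real_derivative f c) (at r within {0..})"
    using ode[of r] t tr by simp
  then obtain d where d: "d > 0" "\<And>h. 0 < h \<Longrightarrow> r - h \<in> {0..} \<Longrightarrow> h < d \<Longrightarrow> z (r - h) < z r"
    using has_real_derivative_pos_inc_left[OF _ pos] by blast
  \<comment> \<open>This keeps \<open>r - h\<close> both in \<open>[t, r)\<close>, where
    \<open>z > c\<close>, and close enough to \<open>r\<close> for the positive derivative to give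
    \<open>z (r - h) < z r = c\<close>.\<close>
  define h where "h = min (d / 2) (r - t)"
  have "0 < h" "h < d" "h \<le> r - t" using d tr by (auto simp: h_def)
  then show False using d(2)[of h] before[of "r - h"] \<open>z r = c\<close> t by auto
qed

text \<open>\<open>G\<close> is the antiderivative of \<open>1 / (1 + \<gamma>)\<close> on
  \<open>{0..1}\<close> that vanishes at 0. By the chain rule \<open>G (z t) - t\<close> is
  constant, and comparing times 0 and \<open>T\<close> gives \<open>G 1 = T\<close>. The increment
  bounds follow from the mean value theorem, since the integrand lies in \<open>[0, 1]\<close> and
  inherits the Lipschitz constant \<open>L\<close>.\<close>

lemma hitting_time_potential:
  fixes \<gamma> z :: "real \<Rightarrow> real"
  assumes lip: "L-lipschitz_on {0..} \<gamma>"
    and nonneg: "\<And>u. 0 \<le> u \<Longrightarrow> u \<le> 1 \<Longrightarrow> 0 \<le> \<gamma> u"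
    and z_nonneg: "\<And>t. t \<ge> 0 \<Longrightarrow> z t \<ge> 0"
    and ode: "\<And>t. t \<ge> 0 \<Longrightarrow> (z has_real_derivative 1 + \<gamma> (z t)) (at t within {0..})"
    and init: "z 0 = 0" and T: "T \<ge> 0" "z T = 1"
  obtains G :: "real \<Rightarrow> real" where "G 0 = 0" "G 1 = T"
    "\<And>x y. 0 \<le> x \<Longrightarrow> x \<le> y \<Longrightarrow> y \<le> 1 \<Longrightarrow> 0 \<le> G y - G x \<and> G y - G x \<le> y - x"
    "\<And>x y. 0 \<le> x \<Longrightarrow> x \<le> y \<Longrightarrow> y \<le> 1 \<Longrightarrow>
      \<bar>G y - G x - (y - x) / (1 + \<gamma> x)\<bar> \<le> L * (y - x)\<^sup>2"
proof -
  define H where "H u = 1 / (1 + \<gamma> u)" for u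
  have H01: "0 \<le> H u" "H u \<le> 1" if "0 \<le> u" "u \<le> 1" for u
    using nonneg[OF that] by (auto simp: H_def)
  have "continuous_on {0..1} \<gamma>"
    using lipschitz_on_continuous_on[OF lip] by (rule continuous_on_subset) auto
  then have "continuous_on {0..1} H"
    unfolding H_def by (intro continuous_intros) (use nonneg in \<open>force+\<close>)
  then obtain G0 where G0: "\<And>x. x \<in> {0..1} \<Longrightarrow> (G0 has_vector_derivative H x) (at x within {0..1})"
    using antiderivative_continuous by blast
  define G where "G x = G0 x - G0 0" for x
  have G': "(G has_real_derivative H x) (at x within {0..1})" if "x \<in> {0..1}" for x
    using G0[OF that] unfolding G_def has_real_derivative_iff_has_vector_derivative
    by (auto intro!: derivative_eq_intros)
  have mvt: "\<exists>w\<in>{x..y}. G y - G x = H w * (y - x)" if "0 \<le> x" "x \<le> y" "y \<le> 1" for x y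
    using that
    by (intro mvt_very_simple has_derivative_subset[OF G'[unfolded has_field_derivative_def]]) auto
  \<comment> \<open>The trajectory must not leave \<open>{0..1}\<close>, where alone
    \<open>G\<close> is differentiated.\<close>
  have z1: "z t \<in> {0..1}" if "t \<in> {0..T}" for t
    using ode_le_until_hit[where z = z and f = "\<lambda>u. 1 + \<gamma> u" and c = 1 and T = T] ode nonneg[of 1] T z_nonneg that
    by auto
  have "((\<lambda>t. G (z t) - t) has_real_derivative 0) (at t within {0..T})" if t: "t \<in> {0..T}" for t
  proof -
    have "(z has_real_derivative 1 + \<gamma> (z t)) (at t within {0..T})"
      by (rule has_field_derivative_subset[OF ode]) (use t in auto)
    moreover have "(G has_real_derivative H (z t)) (at (z t) within z ` {0..T})"
      by (rule has_field_derivative_subset[OF G'[OF z1[OF t]]]) (use z1 in auto)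
    ultimately have "(G \<circ> z has_real_derivative H (z t) * (1 + \<gamma> (z t))) (at t within {0..T})"
      by (intro DERIV_image_chain)
    moreover have "H (z t) * (1 + \<gamma> (z t)) = 1"
      using nonneg[of "z t"] z1[OF t] by (simp add: H_def)
    ultimately show ?thesis
      by (auto intro!: derivative_eq_intros simp: o_def)
  qed
  then have "\<exists>c. \<forall>t\<in>{0..T}. G (z t) - t = c"
    by (intro has_field_derivative_zero_constant) auto
  then obtain c where "\<And>t. t \<in> {0..T} \<Longrightarrow> G (z t) - t = c" by blast
  from this[of 0] this[of T] have "G 1 = T" using T init by (simp add: G_def)
  moreover have "0 \<le> G y - G x \<and> G y - G x \<le> y - x" if xy: "0 \<le> x" "x \<le> y" "y \<le> 1" for x y
  proof -
    obtain w where "w \<in> {x..y}" "G y - G x = H w * (y - x)" using mvt[OF xy] by blast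
    then show ?thesis using H01[of w] xy by (auto intro: mult_left_le_one_le)
  qed
  moreover have "\<bar>G y - G x - (y - x) / (1 + \<gamma> x)\<bar> \<le> L * (y - x)\<^sup>2"
    if xy: "0 \<le> x" "x \<le> y" "y \<le> 1" for x y
  proof -
    obtain w where w: "w \<in> {x..y}" "G y - G x = H w * (y - x)" using mvt[OF xy] by blast
    have g: "0 \<le> \<gamma> w" "0 \<le> \<gamma> x" using w xy nonneg by auto
    \<comment> \<open>Both factors \<open>H w\<close> and \<open>H x\<close> are at most 1, so
      \<open>H\<close> varies no more than \<open>\<gamma>\<close>.\<close>
    have "H w - H x = (\<gamma> x - \<gamma> w) * (H w * H x)"
      using g by (simp add: H_def field_simps)
    then have "\<bar>H w - H x\<bar> = \<bar>\<gamma> x - \<gamma> w\<bar> * (H w * H x)"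
      using H01[of w] H01[of x] w xy by (simp add: abs_mult)
    also have "\<dots> \<le> \<bar>\<gamma> x - \<gamma> w\<bar>"
      using H01[of w] H01[of x] w xy by (intro mult_right_le_one_le mult_le_one) auto
    also have "\<dots> \<le> L * \<bar>x - w\<bar>"
      using lipschitz_onD[OF lip, of x w] w xy by (auto simp: dist_real_def)
    also have "\<dots> \<le> L * (y - x)"
      using w by (intro mult_left_mono lipschitz_on_nonneg[OF lip]) auto
    finally have "\<bar>H w - H x\<bar> * (y - x) \<le> L * (y - x) * (y - x)"
      using xy by (intro mult_right_mono) auto
    moreover have "G y - G x - (y - x) / (1 + \<gamma> x) = (H w - H x) * (y - x)"
      using w by (simp add: H_def algebra_simps)
    ultimately show ?thesis using xy by (simp add: abs_mult power2_eq_square)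
  qed
  ultimately show thesis using that[of G] by (simp add: G_def)
qed

section \<open>Pathwise behaviour of the exploration\<close>

text \<open>A path climbs by at least 1 per step until it rests at \<open>N\<close>, so it arrives
  by step \<open>N\<close>, and the hitting time equals the number of steps \<open>i < N\<close>
  spent below \<open>N\<close>. Such a count is a finite sum of indicators, convenient for
  measurability and for increments.\<close>

lemma final_active_path:
  assumes N: "N > 0" and init: "Z 0 \<omega> = 0" and le: "\<And>n. Z n \<omega> \<le> N"
    and incr: "\<And>n. Z n \<omega> < N \<Longrightarrow> Z n \<omega> < Z (Suc n) \<omega>"
    and absorb: "\<And>n. Z n \<omega> = N \<Longrightarrow> Z (Suc n) \<omega> = N"
  shows "final_active N Z \<omega> = enat (card {i. i < N \<and> Z i \<omega> < N})"
    and "Z N \<omega> = N"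
    and "Z n \<omega> < N \<Longrightarrow> card {i. i < n \<and> Z i \<omega> < N} = n"
proof -
  have "min n N \<le> Z n \<omega>" for n
  proof (induction n)
    case (Suc n)
    show ?case using Suc incr[of n] absorb[of n] le[of n] by (cases "Z n \<omega> < N") auto
  qed simp
  from this[of N] le[of N] show ZN: "Z N \<omega> = N" by simp
  have stay: "Z m \<omega> = N" if "Z n \<omega> = N" "n \<le> m" for n m
    using that(2,1) by (induction rule: dec_induct) (simp_all add: absorb)
  define T where "T = (LEAST n. Z n \<omega> = N)"
  have T: "Z T \<omega> = N" "T \<le> N" "\<And>n. Z n \<omega> = N \<Longrightarrow> T \<le> n"
    using ZN unfolding T_def by (auto intro: LeastI Least_le)
  have iff: "Z i \<omega> < N \<longleftrightarrow> i < T" for i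
    using stay[OF T(1), of i] T(3)[of i] le[of i] by (metis le_neq_implies_less linorder_not_le nat_less_le)
  \<comment> \<open>The infimum in \<open>final_active\<close> starts at 1, the \<open>LEAST\<close>
    at 0; they agree because \<open>Z 0 \<omega> = 0 < N\<close>.\<close>
  have "T \<noteq> 0" using T(1) init N by (metis less_numeral_extra(3))
  then have "final_active N Z \<omega> = enat T"
    unfolding final_active_def using T
    by (intro antisym INF_lower2[of T] INF_greatest) auto
  moreover have "{i. i < N \<and> Z i \<omega> < N} = {..<T}" using T(2) by (auto simp: iff)
  ultimately show "final_active N Z \<omega> = enat (card {i. i < N \<and> Z i \<omega> < N})" by simp
  show "card {i. i < n \<and> Z i \<omega> < N} = n" if "Z n \<omega> < N"
  proof -
    have "{i. i < n \<and> Z i \<omega> < N} = {..<n}" using that by (auto simp: iff)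
    then show ?thesis by simp
  qed
qed

section \<open>Transition laws of the chain and the second moment estimate\<close>

context exploration_chain
begin

text \<open>Since \<open>markov\<close> conditions on the whole history, the event
  \<open>Z n = x\<close> is split into the countably many histories ending in \<open>x\<close>; the
  transition probability depends on the last state only and factors out of the sum.\<close>

lemma transition_prob:
  "\<P>(\<omega> in M. Z n \<omega> = x \<and> Z (Suc n) \<omega> = y)
    = \<P>(\<omega> in M. Z n \<omega> = x) * pmf (exploration_kernel N q x) y"
proof -
  note [measurable] = Z_measurable
  \<comment> \<open>Histories are coded as lists of length \<open>n + 1\<close>, so that the index
    set is countable.\<close>
  define I where "I = {l :: nat list. length l = Suc n \<and> l ! n = x}"
  define E where "E l = {\<omega> \<in> space M. \<forall>i\<le>n. Z i \<omega> = l ! i}" for l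
  define B where "B = {\<omega> \<in> space M. Z (Suc n) \<omega> = y}"
  define c where "c = pmf (exploration_kernel N q x) y"
  have [measurable]: "E l \<in> sets M" "B \<in> sets M" for l
    unfolding E_def B_def by measurable
  have disj: "disjoint_family_on E I"
    by (auto simp: disjoint_family_on_def E_def I_def intro!: nth_equalityI simp: less_Suc_eq_le)
  then have disj': "disjoint_family_on (\<lambda>l. E l \<inter> B) I"
    by (auto simp: disjoint_family_on_def)
  have "\<omega> \<in> (\<Union>l\<in>I. E l)" if "\<omega> \<in> space M" "Z n \<omega> = x" for \<omega>
    using that
    by (intro UN_I[of "map (\<lambda>i. Z i \<omega>) [0..<Suc n]"]) (auto simp: I_def E_def nth_append less_Suc_eq_le simp del: upt_Suc)
  then have U: "(\<Union>l\<in>I. E l) = {\<omega> \<in> space M. Z n \<omega> = x}"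
    by (auto simp: E_def I_def)
  have step: "emeasure M (E l \<inter> B) = emeasure M (E l) * ennreal c" if "l \<in> I" for l
  proof -
    have "prob (E l \<inter> B) = prob (E l) * c"
    proof (cases "prob (E l) > 0")
      case True
      have "E l \<inter> B = {\<omega> \<in> space M. Z (Suc n) \<omega> = y \<and> (\<forall>i\<le>n. Z i \<omega> = l ! i)}"
        by (auto simp: E_def B_def)
      then show ?thesis
        using markov[of n "(!) l" y] True that
        by (simp add: cond_prob_def I_def E_def c_def field_simps)
    next
      \<comment> \<open>For a history of probability zero \<open>markov\<close> gives nothing, but
        both sides vanish.\<close>
      case False
      then have "prob (E l) = 0" by (simp add: zero_less_measure_iff)
      moreover have "prob (E l \<inter> B) \<le> prob (E l)" by (rule finite_measure_mono) auto
      ultimately show ?thesis by (simp add: measure_le_0_iff)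
    qed
    then show ?thesis
      by (simp add: emeasure_eq_measure ennreal_mult' c_def)
  qed
  have "emeasure M ((\<Union>l\<in>I. E l) \<inter> B) = emeasure M (\<Union>l\<in>I. E l \<inter> B)"
    by (simp add: Int_UN_distrib2)
  also have "\<dots> = (\<integral>\<^sup>+ l. emeasure M (E l \<inter> B) \<partial>count_space I)"
    by (rule emeasure_UN_countable[OF _ _ disj']) auto
  also have "\<dots> = (\<integral>\<^sup>+ l. emeasure M (E l) * ennreal c \<partial>count_space I)"
    by (rule nn_integral_cong) (simp add: step)
  also have "\<dots> = (\<integral>\<^sup>+ l. emeasure M (E l) \<partial>count_space I) * ennreal c"
    by (rule nn_integral_multc) auto
  also have "(\<integral>\<^sup>+ l. emeasure M (E l) \<partial>count_space I) = emeasure M (\<Union>l\<in>I. E l)"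
    by (rule emeasure_UN_countable[OF _ _ disj, symmetric]) auto
  finally have "prob ((\<Union>l\<in>I. E l) \<inter> B) = prob (\<Union>l\<in>I. E l) * c"
    by (simp add: emeasure_eq_measure ennreal_mult'[symmetric] c_def)
  moreover have "{\<omega> \<in> space M. Z n \<omega> = x} \<inter> B = {\<omega> \<in> space M. Z n \<omega> = x \<and> Z (Suc n) \<omega> = y}"
    by (auto simp: B_def)
  ultimately show ?thesis unfolding U c_def by simp
qed

text \<open>Each impossible transition is a null event, and there are only countably many triples
  \<open>n\<close>, \<open>x\<close>, \<open>y\<close>.\<close>

lemma AE_step: "AE \<omega> in M. \<forall>n. Z (Suc n) \<omega> \<in> set_pmf (exploration_kernel N q (Z n \<omega>))"
proof -
  note [measurable] = Z_measurable
  have "AE \<omega> in M. \<not> (Z n \<omega> = x \<and> Z (Suc n) \<omega> = y)"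
    if "y \<notin> set_pmf (exploration_kernel N q x)" for n x y
  proof -
    have "\<P>(\<omega> in M. Z n \<omega> = x \<and> Z (Suc n) \<omega> = y) = 0"
      using transition_prob[of n x y] that by (simp add: pmf_eq_0_set_pmf)
    then show ?thesis by (subst (asm) prob_Collect_eq_0) measurable
  qed
  then have "AE \<omega> in M. \<forall>n x y. y \<notin> set_pmf (exploration_kernel N q x) \<longrightarrow> \<not> (Z n \<omega> = x \<and> Z (Suc n) \<omega> = y)"
    by (intro AE_all_countable[THEN iffD2] allI AE_impI) blast
  then show ?thesis by eventually_elim blast
qed

lemma set_kernel: "x < N \<Longrightarrow> set_pmf (exploration_kernel N q x) \<subseteq> {x<..N}"
  using support[of x] by (force simp: exploration_kernel_def)

text \<open>Supplies, almost surely, the path hypotheses of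
  \<open>final_active_path\<close>.\<close>

lemma AE_path:
  "AE \<omega> in M. Z 0 \<omega> = 0 \<and> (\<forall>n. Z n \<omega> \<le> N) \<and> (\<forall>n. Z n \<omega> < N \<longrightarrow> Z n \<omega> < Z (Suc n) \<omega>)
    \<and> (\<forall>n. Z n \<omega> = N \<longrightarrow> Z (Suc n) \<omega> = N)"
  using start AE_step
proof eventually_elim
  case (elim \<omega>)
  have abs: "Z (Suc n) \<omega> = N" if "Z n \<omega> = N" for n
    using elim(2)[rule_format, of n] that by (simp add: exploration_kernel_def)
  have inc: "Z n \<omega> < Z (Suc n) \<omega> \<and> Z (Suc n) \<omega> \<le> N" if "Z n \<omega> < N" for n
    using elim(2)[rule_format, of n] set_kernel[OF that] by auto
  have "Z n \<omega> \<le> N" for n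
  proof (induction n)
    case (Suc n)
    then show ?case using abs[of n] inc[of n] by (cases "Z n \<omega> = N") auto
  qed (use elim in simp)
  then show ?case using elim abs inc by auto
qed

text \<open>This takes the place of conditioning on \<open>Z n\<close>. Two consecutive states
  almost surely lie in a finite square, so the expectation is a finite sum for arbitrary
  \<open>g\<close>, and \<open>transition_prob\<close> regroups it by the current state.\<close>

lemma one_step_expectation_le:
  fixes g :: "nat \<Rightarrow> nat \<Rightarrow> real"
  assumes c: "c \<ge> 0"
    and le: "\<And>x. x \<le> N \<Longrightarrow> measure_pmf.expectation (exploration_kernel N q x) (g x) \<le> c"
  shows "expectation (\<lambda>\<omega>. g (Z n \<omega>) (Z (Suc n) \<omega>)) \<le> c"
proof -
  note [measurable] = Z_measurable
  define J where "J x y = {\<omega> \<in> space M. Z n \<omega> = x \<and> Z (Suc n) \<omega> = y}" for x y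
  have [measurable]: "J x y \<in> sets M" for x y unfolding J_def by measurable
  have "expectation (\<lambda>\<omega>. g (Z n \<omega>) (Z (Suc n) \<omega>))
      = expectation (\<lambda>\<omega>. \<Sum>x\<le>N. \<Sum>y\<le>N. g x y * indicator (J x y) \<omega>)"
  proof (rule integral_cong_AE)
    have "(\<lambda>\<omega>. case_prod g (Z n \<omega>, Z (Suc n) \<omega>)) \<in> borel_measurable M"
      by (rule measurable_compose[of _ _ "count_space UNIV"]) measurable
    then show "(\<lambda>\<omega>. g (Z n \<omega>) (Z (Suc n) \<omega>)) \<in> borel_measurable M" by simp
    show "AE \<omega> in M. g (Z n \<omega>) (Z (Suc n) \<omega>)
        = (\<Sum>x\<le>N. \<Sum>y\<le>N. g x y * indicator (J x y) \<omega>)"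
      using AE_path AE_space
    proof eventually_elim
      case (elim \<omega>)
      have "(\<Sum>x\<le>N. \<Sum>y\<le>N. g x y * indicator (J x y) \<omega>)
        = (\<Sum>x\<le>N. if x = Z n \<omega> then \<Sum>y\<le>N. if y = Z (Suc n) \<omega> then g x y else 0 else 0)"
        using elim by (intro sum.cong refl) (auto simp: J_def indicator_def intro!: sum.cong)
      then show ?case using elim by (simp add: sum.delta)
    qed
  qed measurable
  also have "\<dots> = (\<Sum>x\<le>N. \<Sum>y\<le>N. g x y * prob (J x y))"
  proof -
    have "integrable M (\<lambda>\<omega>. g x y * indicator (J x y) \<omega>)" for x y
      by (intro integrable_mult_right) (simp add: less_top[symmetric])
    then show ?thesis by (simp add: Bochner_Integration.integral_sum del: sum_mult_indicator)
  qed
  also have "\<dots> = (\<Sum>x\<le>N. prob {\<omega> \<in> space M. Z n \<omega> = x}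
      * (\<Sum>y\<le>N. g x y * pmf (exploration_kernel N q x) y))"
    by (simp only: J_def transition_prob sum_distrib_left) (simp only: mult_ac)
  also have "\<dots> = (\<Sum>x\<le>N. prob {\<omega> \<in> space M. Z n \<omega> = x}
      * measure_pmf.expectation (exploration_kernel N q x) (g x))"
  proof (intro sum.cong refl arg_cong2[where f = "(*)"])
    fix x assume "x \<in> {..N}"
    then have "set_pmf (exploration_kernel N q x) \<subseteq> {..N}"
      using set_kernel[of x] by (cases "x < N") (auto simp: exploration_kernel_def)
    then show "(\<Sum>y\<le>N. g x y * pmf (exploration_kernel N q x) y)
        = measure_pmf.expectation (exploration_kernel N q x) (g x)"
      by (subst integral_measure_pmf_real[of "{..N}"]) auto
  qed
  also have "\<dots> \<le> (\<Sum>x\<le>N. prob {\<omega> \<in> space M. Z n \<omega> = x} * c)"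
    by (intro sum_mono mult_left_mono le) auto
  also have "\<dots> = prob (\<Union>x\<le>N. {\<omega> \<in> space M. Z n \<omega> = x}) * c"
    by (subst finite_measure_finite_Union) (auto simp: disjoint_family_on_def sum_distrib_right)
  \<comment> \<open>The total mass is at most 1, and \<open>c\<close> is nonnegative.\<close>
  also have "\<dots> \<le> c" using c by (intro mult_left_le_one_le) auto
  finally show ?thesis .
qed

text \<open>With \<open>d\<close> the increment of \<open>V\<close>, one step changes
  \<open>V\<^sup>2\<close> by \<open>2 * V * d + d\<^sup>2\<close>. Given the current state this has
  mean at most \<open>2 * a + b\<close>, because \<open>V\<close> is bounded by 1. Summing
  \<open>N\<close> steps bounds \<open>V N\<close>, which equals \<open>X\<close> almost surely. The
  function \<open>g\<close> stands for \<open>G (x / N)\<close>.\<close>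

lemma final_active_L2_bound:
  fixes g :: "nat \<Rightarrow> real" and a b :: real
  assumes N: "N > 0" and g0: "g 0 = 0"
    and g01: "\<And>x. x \<le> N \<Longrightarrow> 0 \<le> g x \<and> g x \<le> 1"
    and mean: "\<And>x. x < N \<Longrightarrow>
      \<bar>measure_pmf.expectation (q x) (\<lambda>k. 1 / N - (g (x + 1 + k) - g x))\<bar> \<le> a"
    and square: "\<And>x. x < N \<Longrightarrow>
      measure_pmf.expectation (q x) (\<lambda>k. (1 / N - (g (x + 1 + k) - g x))\<^sup>2) \<le> b"
  defines "X \<equiv> \<lambda>\<omega>. real (card {i. i < N \<and> Z i \<omega> < N}) / N - g N"
  shows "integrable M X" and "integrable M (\<lambda>\<omega>. (X \<omega>)\<^sup>2)"
    and "expectation (\<lambda>\<omega>. (X \<omega>)\<^sup>2) \<le> N * (2 * a + b)"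
proof -
  note [measurable] = Z_measurable
  define V where "V n \<omega> = real (card {i. i < n \<and> Z i \<omega> < N}) / N - g (Z n \<omega>)" for n \<omega>
  have card_eq: "real (card {i. i < n \<and> Z i \<omega> < N}) = (\<Sum>i<n. if Z i \<omega> < N then 1 else 0)" for n \<omega>
    by (simp add: sum.If_cases lessThan_def Collect_conj_eq)
  have [measurable]: "(\<lambda>\<omega>. g (Z n \<omega>)) \<in> borel_measurable M" for n
    by (rule measurable_compose[OF Z_measurable]) simp
  have [measurable]: "V n \<in> borel_measurable M" for n
    unfolding V_def card_eq by measurable
  have bound: "AE \<omega> in M. norm (V n \<omega>) \<le> 1" if "n \<le> N" for n
    using AE_path
  proof eventually_elim
    case (elim \<omega>)
    have "card {i. i < n \<and> Z i \<omega> < N} \<le> card {..<n}" by (rule card_mono) auto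
    then have "real (card {i. i < n \<and> Z i \<omega> < N}) / N \<le> 1" using that N by simp
    moreover have "0 \<le> real (card {i. i < n \<and> Z i \<omega> < N}) / N" by simp
    moreover have *: "Z n \<omega> \<le> N" using elim by blast
    ultimately show ?case using g01[of "Z n \<omega>"] * unfolding V_def real_norm_def by linarith
  qed
  have int: "integrable M (V n)" if "n \<le> N" for n
    using bound[OF that] by (intro integrable_const_bound[where B = 1]) auto
  have int2: "integrable M (\<lambda>\<omega>. (V n \<omega>)\<^sup>2)" if "n \<le> N" for n
    using bound[OF that] by (intro integrable_const_bound[where B = 1]) (auto simp: abs_square_le_1)
  \<comment> \<open>Both signs are read off at state 0, which is below \<open>N\<close>.\<close>
  have a: "a \<ge> 0" and b: "b \<ge> 0"
    by (rule order_trans[OF abs_ge_zero mean[OF N]])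
      (rule order_trans[OF integral_nonneg_AE square[OF N]], simp)
  have V2: "expectation (\<lambda>\<omega>. (V n \<omega>)\<^sup>2) \<le> n * (2 * a + b)" if "n \<le> N" for n
    using that
  proof (induction n)
    case 0
    have "expectation (\<lambda>\<omega>. (V 0 \<omega>)\<^sup>2) = expectation (\<lambda>\<omega>. 0)"
      using start by (intro integral_cong_AE) (auto simp: V_def g0)
    then show ?case by simp
  next
    case (Suc n)
    define d where "d x y = 1 / N - (g y - g x)" for x y
    \<comment> \<open>While the chain is below \<open>N\<close>, every earlier step counts and
      \<open>V n = n / N - g (Z n)\<close>, so the increment of \<open>V\<^sup>2\<close> is a
      function of two consecutive states, as \<open>one_step_expectation_le\<close> requires. At
      \<open>N\<close> the value of \<open>V\<close> is frozen.\<close>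
    define h where "h x y = (if x < N then 2 * (n / N - g x) * d x y + (d x y)\<^sup>2 else 0)" for x y
    have "expectation (\<lambda>\<omega>. h (Z n \<omega>) (Z (Suc n) \<omega>)) \<le> 2 * a + b"
    proof (rule one_step_expectation_le)
      fix x assume "x \<le> N"
      show "measure_pmf.expectation (exploration_kernel N q x) (h x) \<le> 2 * a + b"
      proof (cases "x < N")
        case True
        have [simp]: "integrable (measure_pmf (q x)) f" for f :: "nat \<Rightarrow> real"
          using support[OF True] by (intro integrable_measure_pmf_finite) (rule finite_subset, auto)
        have "measure_pmf.expectation (exploration_kernel N q x) (h x)
          = 2 * (n / N - g x) * measure_pmf.expectation (q x) (\<lambda>k. d x (x + 1 + k))
            + measure_pmf.expectation (q x) (\<lambda>k. (d x (x + 1 + k))\<^sup>2)"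
          using True by (simp add: exploration_kernel_def h_def)
        also have "\<dots> \<le> 2 * (1 * a) + b"
        proof (intro add_mono)
          have "\<bar>(n / N - g x) * measure_pmf.expectation (q x) (\<lambda>k. d x (x + 1 + k))\<bar> \<le> 1 * a"
            unfolding abs_mult
          proof (intro mult_mono)
            \<comment> \<open>Both \<open>n / N\<close> and \<open>g x\<close> lie in
              \<open>[0, 1]\<close>; this is where the restriction to \<open>N\<close> steps
              enters.\<close>
            have "0 \<le> real n / N" "real n / N \<le> 1" using Suc.prems by auto
            then show "\<bar>n / N - g x\<bar> \<le> 1" using g01[OF \<open>x \<le> N\<close>] by linarith
          qed (use mean[OF True] in \<open>simp_all add: d_def\<close>)
          then show "2 * (n / N - g x) * measure_pmf.expectation (q x) (\<lambda>k. d x (x + 1 + k))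
              \<le> 2 * (1 * a)" by (simp only: mult.assoc)
        qed (use square[OF True] in \<open>simp add: d_def\<close>)
        finally show ?thesis by simp
      next
        case False
        then show ?thesis using a b by (simp add: h_def[abs_def])
      qed
    qed (use a b in simp)
    moreover have "expectation (\<lambda>\<omega>. h (Z n \<omega>) (Z (Suc n) \<omega>))
        = expectation (\<lambda>\<omega>. (V (Suc n) \<omega>)\<^sup>2 - (V n \<omega>)\<^sup>2)"
    proof (rule integral_cong_AE)
      show "(\<lambda>\<omega>. h (Z n \<omega>) (Z (Suc n) \<omega>)) \<in> borel_measurable M"
        unfolding h_def d_def by measurable
      show "AE \<omega> in M. h (Z n \<omega>) (Z (Suc n) \<omega>) = (V (Suc n) \<omega>)\<^sup>2 - (V n \<omega>)\<^sup>2"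
        using AE_path
      proof eventually_elim
        case (elim \<omega>)
        show ?case
        proof (cases "Z n \<omega> < N")
          case True
          have "card {i. i < n \<and> Z i \<omega> < N} = n"
            by (rule final_active_path(3)) (use N elim True in auto)
          then have "V n \<omega> = n / N - g (Z n \<omega>)"
            and "V (Suc n) \<omega> = V n \<omega> + d (Z n \<omega>) (Z (Suc n) \<omega>)"
            using True card_eq[of n \<omega>] card_eq[of "Suc n" \<omega>]
            by (simp_all add: V_def d_def add_divide_distrib)
          then show ?thesis using True by (simp add: h_def power2_sum)
        next
          case False
          then have "Z n \<omega> = N" "Z (Suc n) \<omega> = N" using elim by (auto simp: not_less antisym)
          then have "V (Suc n) \<omega> = V n \<omega>"
            using card_eq[of n \<omega>] card_eq[of "Suc n" \<omega>] by (simp add: V_def)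
          then show ?thesis using False by (simp add: h_def)
        qed
      qed
    qed measurable
    ultimately show ?case
      using Suc int2[of n] int2[of "Suc n"] by (simp add: Bochner_Integration.integral_diff algebra_simps)
  qed
  have VX: "AE \<omega> in M. V N \<omega> = X \<omega>"
    using AE_path
  proof eventually_elim
    case (elim \<omega>)
    have "Z N \<omega> = N" by (rule final_active_path(2)) (use N elim in auto)
    then show ?case by (simp add: V_def X_def)
  qed
  have [measurable]: "X \<in> borel_measurable M"
    unfolding X_def card_eq by measurable
  show "integrable M X" "integrable M (\<lambda>\<omega>. (X \<omega>)\<^sup>2)"
    using VX by (auto intro: integrable_cong_AE_imp[OF int[of N]] integrable_cong_AE_imp[OF int2[of N]])
  have "expectation (\<lambda>\<omega>. (X \<omega>)\<^sup>2) = expectation (\<lambda>\<omega>. (V N \<omega>)\<^sup>2)"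
    using VX by (intro integral_cong_AE) auto
  then show "expectation (\<lambda>\<omega>. (X \<omega>)\<^sup>2) \<le> N * (2 * a + b)"
    using V2[of N] by simp
qed

end

section \<open>Moments of a single jump and the sign of the limiting drift\<close>

text \<open>This is nonnegativity of the variance of \<open>\<bar>X\<bar>\<close>.\<close>

lemma (in prob_space) expectation_abs_le_sqrt:
  fixes X :: "'a \<Rightarrow> real"
  assumes "integrable M X" "integrable M (\<lambda>\<omega>. (X \<omega>)\<^sup>2)"
  shows "expectation (\<lambda>\<omega>. \<bar>X \<omega>\<bar>) \<le> sqrt (expectation (\<lambda>\<omega>. (X \<omega>)\<^sup>2))"
proof (rule real_le_rsqrt)
  show "(expectation (\<lambda>\<omega>. \<bar>X \<omega>\<bar>))\<^sup>2 \<le> expectation (\<lambda>\<omega>. (X \<omega>)\<^sup>2)"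
    using variance_eq[of "\<lambda>\<omega>. \<bar>X \<omega>\<bar>"] variance_positive[of "\<lambda>\<omega>. \<bar>X \<omega>\<bar>"] assms by simp
qed

text \<open>The chain jumps by \<open>1 + k\<close>, so this converts bounds on
  \<open>dispersion\<close> and \<open>drift\<close> into a bound on the second moment of a jump.
  The cross term vanishes because \<open>m\<close> is the mean.\<close>

lemma pmf_second_moment_Suc:
  fixes Q :: "nat pmf"
  assumes "finite (set_pmf Q)"
  defines "m \<equiv> measure_pmf.expectation Q real"
  shows "measure_pmf.expectation Q (\<lambda>k. (1 + real k)\<^sup>2)
    = measure_pmf.expectation Q (\<lambda>k. (real k - m)\<^sup>2) + (1 + m)\<^sup>2"
proof -
  have [simp]: "integrable (measure_pmf Q) f" for f :: "nat \<Rightarrow> real"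
    using assms(1) by (rule integrable_measure_pmf_finite)
  have "(1 + real k)\<^sup>2 = (real k - m)\<^sup>2 + 2 * (1 + m) * (real k - m) + (1 + m)\<^sup>2" for k
    by (simp add: power2_eq_square algebra_simps)
  then have "measure_pmf.expectation Q (\<lambda>k. (1 + real k)\<^sup>2)
    = measure_pmf.expectation Q (\<lambda>k. (real k - m)\<^sup>2)
      + 2 * (1 + m) * (measure_pmf.expectation Q real - m) + (1 + m)\<^sup>2"
    by simp
  then show ?thesis by (simp add: m_def)
qed

text \<open>Here \<open>e k\<close> is the gain of the potential in a jump by \<open>1 + k\<close>,
  and \<open>c\<close> is its slope \<open>1 / (1 + \<gamma>)\<close> at the current state. The
  linear part leaves the mean \<open>1 - c * (1 + m)\<close>, which is zero when \<open>m\<close>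
  equals the limiting drift; the remainder is quadratic in the jump.\<close>

lemma potential_increment_moments:
  fixes Q :: "nat pmf" and e :: "nat \<Rightarrow> real" and N :: nat
  assumes fin: "finite (set_pmf Q)" and N: "N > 0"
    and e: "\<And>k. k \<in> set_pmf Q \<Longrightarrow> 0 \<le> e k \<and> e k \<le> (1 + real k) / N"
    and lin: "\<And>k. k \<in> set_pmf Q \<Longrightarrow> \<bar>e k - c * ((1 + real k) / N)\<bar> \<le> L * ((1 + real k) / N)\<^sup>2"
  defines "S \<equiv> measure_pmf.expectation Q (\<lambda>k. (1 + real k)\<^sup>2)"
    and "m \<equiv> measure_pmf.expectation Q real"
  shows "\<bar>measure_pmf.expectation Q (\<lambda>k. 1 / N - e k)\<bar> \<le> \<bar>1 - c * (1 + m)\<bar> / N + L * (S / N\<^sup>2)"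
    and "measure_pmf.expectation Q (\<lambda>k. (1 / N - e k)\<^sup>2) \<le> S / N\<^sup>2"
proof -
  have [simp]: "integrable (measure_pmf Q) f" for f :: "nat \<Rightarrow> real"
    using fin by (rule integrable_measure_pmf_finite)
  have S: "measure_pmf.expectation Q (\<lambda>k. ((1 + real k) / N)\<^sup>2) = S / N\<^sup>2"
    by (simp add: S_def power_divide)
  define r where "r k = c * ((1 + real k) / N) - e k" for k
  have "measure_pmf.expectation Q (\<lambda>k. 1 / N - e k)
      = measure_pmf.expectation Q (\<lambda>k. (1 - c * (1 + real k)) / N + r k)"
    by (simp add: r_def diff_divide_distrib)
  also have "\<dots> = (1 - c * (1 + m)) / N + measure_pmf.expectation Q r"
    by (simp add: m_def)
  finally have "\<bar>measure_pmf.expectation Q (\<lambda>k. 1 / N - e k)\<bar>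
      \<le> \<bar>1 - c * (1 + m)\<bar> / N + \<bar>measure_pmf.expectation Q r\<bar>"
    using abs_triangle_ineq[of "(1 - c * (1 + m)) / N" "measure_pmf.expectation Q r"] N by simp
  moreover have "\<bar>measure_pmf.expectation Q r\<bar> \<le> measure_pmf.expectation Q (\<lambda>k. \<bar>r k\<bar>)"
    by (rule integral_abs_bound)
  moreover have "\<dots> \<le> measure_pmf.expectation Q (\<lambda>k. L * ((1 + real k) / N)\<^sup>2)"
    using lin by (intro integral_mono_AE) (auto simp: AE_measure_pmf_iff r_def abs_minus_commute)
  moreover have "\<dots> = L * (S / N\<^sup>2)"
    by (simp add: S)
  ultimately show "\<bar>measure_pmf.expectation Q (\<lambda>k. 1 / N - e k)\<bar>
      \<le> \<bar>1 - c * (1 + m)\<bar> / N + L * (S / N\<^sup>2)"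
    by linarith
  \<comment> \<open>Both \<open>1 / N\<close> and \<open>e k\<close> lie between 0 and
    \<open>(1 + k) / N\<close>, hence so does their distance.\<close>
  have "(1 / N - e k)\<^sup>2 \<le> ((1 + real k) / N)\<^sup>2" if "k \<in> set_pmf Q" for k
    proof -
    have "0 \<le> 1 / real N" "1 / N \<le> (1 + real k) / N" using N by (auto intro: divide_right_mono)
    then have "\<bar>1 / N - e k\<bar> \<le> \<bar>(1 + real k) / N\<bar>" using e[OF that] by linarith
    then show ?thesis by (simp only: abs_le_square_iff)
  qed
  then have "measure_pmf.expectation Q (\<lambda>k. (1 / N - e k)\<^sup>2)
      \<le> measure_pmf.expectation Q (\<lambda>k. ((1 + real k) / N)\<^sup>2)"
    by (intro integral_mono_AE) (simp_all add: AE_measure_pmf_iff)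
  then show "measure_pmf.expectation Q (\<lambda>k. (1 / N - e k)\<^sup>2) \<le> S / N\<^sup>2"
    by (simp only: S)
qed

text \<open>Every \<open>drift\<close> is a mean of natural numbers, and each \<open>u\<close> in
  \<open>[0, 1]\<close> is within \<open>1 / N\<close> of a grid point \<open>x / N\<close> with
  \<open>x < N\<close>; the sign passes to the limit.\<close>

lemma nonneg_of_approx:
  fixes p :: "nat \<Rightarrow> nat \<Rightarrow> nat pmf" and \<gamma> :: "real \<Rightarrow> real"
  assumes lip: "L-lipschitz_on {0..} \<gamma>"
    and approx: "\<And>N x. x < N \<Longrightarrow> \<bar>drift p N x - \<gamma> (real x / real N)\<bar> \<le> \<delta> N"
    and lim: "\<delta> \<longlonglongrightarrow> 0" and u: "0 \<le> u" "u \<le> 1"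
  shows "0 \<le> \<gamma> u"
proof -
  have "- \<delta> N - L * (1 / N) \<le> \<gamma> u" if "N > 0" for N
  proof -
    \<comment> \<open>The cap \<open>N - 1\<close> matters at \<open>u = 1\<close>, where the floor
      is \<open>N\<close> and no drift bound is available.\<close>
    define x where "x = min (N - 1) (nat \<lfloor>u * N\<rfloor>)"
    have xN: "x < N" using that by (auto simp: x_def)
    have "u * N \<le> N" using u by (intro mult_left_le_one_le) auto
    moreover have "real (nat \<lfloor>u * N\<rfloor>) = \<lfloor>u * N\<rfloor>" using u by simp
    moreover have "real (N - 1) = real N - 1" using that by simp
    ultimately have "\<bar>real x - u * N\<bar> \<le> 1"
      unfolding x_def of_nat_min by linarith
    then have "\<bar>real x / N - u\<bar> \<le> 1 / N"
      using that by (simp add: field_simps abs_le_iff)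
    then have "L * \<bar>real x / N - u\<bar> \<le> L * (1 / N)"
      by (intro mult_left_mono lipschitz_on_nonneg[OF lip])
    moreover have "\<bar>\<gamma> (real x / N) - \<gamma> u\<bar> \<le> L * \<bar>real x / N - u\<bar>"
      using lipschitz_onD[OF lip, of "real x / N" u] u by (simp add: dist_real_def)
    moreover have "0 \<le> drift p N x" unfolding drift_def by (rule integral_nonneg_AE) simp
    ultimately show ?thesis using approx[OF xN] by linarith
  qed
  then have "eventually (\<lambda>N. - \<delta> N - L * (1 / N) \<le> \<gamma> u) sequentially"
    by (auto intro!: eventually_sequentiallyI[of 1])
  moreover have "(\<lambda>N. - \<delta> N - L * (1 / real N)) \<longlonglongrightarrow> - 0 - L * 0"
    by (intro tendsto_intros lim lim_1_over_n)
  ultimately show ?thesis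
    using tendsto_upperbound[of "\<lambda>N. - \<delta> N - L * (1 / real N)" "- 0 - L * 0" sequentially "\<gamma> u"] by simp
qed

section \<open>Combination of the estimates and passage to the limit\<close>

theorem corollary2p6:
  fixes M :: "nat \<Rightarrow> 'a measure"
    and p :: "nat \<Rightarrow> nat \<Rightarrow> nat pmf"
    and Z :: "nat \<Rightarrow> nat \<Rightarrow> 'a \<Rightarrow> nat"
    and \<gamma> z :: "real \<Rightarrow> real"
    and \<delta> :: "nat \<Rightarrow> real"
    and Tstar :: real
  assumes chain: "\<And>N. N > 0 \<Longrightarrow> exploration_chain (M N) N (p N) (Z N)"
    and lipschitz: "\<exists>L. L-lipschitz_on {0..} \<gamma>"
    and approx: "\<And>N. N > 0 \<Longrightarrow>
          (SUP x\<in>{..<N}. \<bar>drift p N x - \<gamma> (real x / real N)\<bar>) \<le> \<delta> N"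
    and z_nonneg: "\<And>t. t \<ge> 0 \<Longrightarrow> z t \<ge> 0"
    and z_ode: "\<And>t. t \<ge> 0 \<Longrightarrow> (z has_real_derivative 1 + \<gamma> (z t)) (at t within {0..})"
    and z_init: "z 0 = 0"
    and Tstar: "Tstar \<ge> 0" "z Tstar = 1"
    and \<delta>_lim: "\<delta> \<longlonglongrightarrow> 0"
    and drift_small: "max_drift p \<in> o(\<lambda>N. real N)"
    and dispersion_small: "max_dispersion p \<in> o(\<lambda>N. real N)"
  shows "(\<lambda>N. \<integral>\<^sup>+ \<omega>. e2ennreal
            \<bar>ereal_of_enat (final_active N (Z N) \<omega>) / ereal (real N) - ereal Tstar\<bar> \<partial>M N)
          \<longlonglongrightarrow> 0"
  proof -
  obtain L where lip: "L-lipschitz_on {0..} \<gamma>" using lipschitz by blast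
  have L: "L \<ge> 0" by (rule lipschitz_on_nonneg[OF lip])
  have approx': "\<bar>drift p N x - \<gamma> (real x / real N)\<bar> \<le> \<delta> N" if "x < N" for N x
  proof -
    have "\<bar>drift p N x - \<gamma> (real x / real N)\<bar>
        \<le> (SUP x\<in>{..<N}. \<bar>drift p N x - \<gamma> (real x / real N)\<bar>)"
      using that by (intro cSUP_upper) auto
    then show ?thesis using approx[of N] that by linarith
  qed
  have nonneg: "0 \<le> \<gamma> u" if "0 \<le> u" "u \<le> 1" for u
    by (rule nonneg_of_approx[OF lip approx' \<delta>_lim that])
  obtain G where G: "G 0 = 0" "G 1 = Tstar"
    and G_bounds: "\<And>x y. 0 \<le> x \<Longrightarrow> x \<le> y \<Longrightarrow> y \<le> 1 \<Longrightarrow> 0 \<le> G y - G x \<and> G y - G x \<le> y - x"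
    and G_lin: "\<And>x y. 0 \<le> x \<Longrightarrow> x \<le> y \<Longrightarrow> y \<le> 1 \<Longrightarrow>
      \<bar>G y - G x - (y - x) / (1 + \<gamma> x)\<bar> \<le> L * (y - x)\<^sup>2"
    using hitting_time_potential[OF lip nonneg z_nonneg z_ode z_init Tstar] by blast
  \<comment> \<open>On \<open>[0, 1]\<close> the Lipschitz condition gives
    \<open>\<gamma> \<le> \<gamma> 0 + L\<close>, so a jump has mean at most
    \<open>1 + (\<gamma> 0 + L) + \<delta> N\<close>, and \<open>S N\<close> bounds its second
    moment from any state below \<open>N\<close>.\<close>
  define S where "S N = max_dispersion p N + (1 + (\<gamma> 0 + L) + \<delta> N)\<^sup>2" for N
  \<comment> \<open>This is \<open>N * (2 * a + b)\<close> for the bounds \<open>a\<close> and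
    \<open>b\<close> chosen below.\<close>
  define \<epsilon> where "\<epsilon> N = 2 * \<delta> N + (2 * L + 1) * (S N / N)" for N
  have bound: "(\<integral>\<^sup>+ \<omega>. e2ennreal
      \<bar>ereal_of_enat (final_active N (Z N) \<omega>) / ereal (real N) - ereal Tstar\<bar> \<partial>M N)
      \<le> ennreal (sqrt (\<epsilon> N))" if N: "N > 0" for N
  proof -
    interpret exploration_chain "M N" N "p N" "Z N" by (rule chain[OF N])
    define g where "g x = G (real x / N)" for x :: nat
    have fin: "finite (set_pmf (p N x))" if "x < N" for x
      using support[OF that] by (rule finite_subset) simp
    define Q where "Q x = measure_pmf.expectation (p N x) (\<lambda>k. (1 + real k)\<^sup>2)" for x
    have Q: "Q x \<le> S N" if x: "x < N" for x
    proof -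
      have "Q x = dispersion p N x + (1 + drift p N x)\<^sup>2"
        unfolding Q_def dispersion_def drift_def by (rule pmf_second_moment_Suc[OF fin[OF x]])
      moreover have "dispersion p N x \<le> max_dispersion p N"
        unfolding max_dispersion_def using x by (intro cSUP_upper) auto
      moreover have "(1 + drift p N x)\<^sup>2 \<le> (1 + (\<gamma> 0 + L) + \<delta> N)\<^sup>2"
      proof (rule power_mono)
        have "\<bar>\<gamma> (real x / N) - \<gamma> 0\<bar> \<le> L * (real x / N)"
          using lipschitz_onD[OF lip, of "real x / N" 0] by (simp add: dist_real_def)
        also have "\<dots> \<le> L" using L x by (intro mult_right_le_one_le) auto
        finally show "1 + drift p N x \<le> 1 + (\<gamma> 0 + L) + \<delta> N"
          using approx'[OF x] by linarith
        show "0 \<le> 1 + drift p N x"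
          unfolding drift_def by (intro add_nonneg_nonneg integral_nonneg_AE) auto
      qed
      ultimately show ?thesis unfolding S_def by linarith
    qed
    define a where "a = \<delta> N / N + L * (S N / N\<^sup>2)"
    define b where "b = S N / N\<^sup>2"
    have moments: "\<bar>measure_pmf.expectation (p N x) (\<lambda>k. 1 / N - (g (x + 1 + k) - g x))\<bar> \<le> a
        \<and> measure_pmf.expectation (p N x) (\<lambda>k. (1 / N - (g (x + 1 + k) - g x))\<^sup>2) \<le> b"
      if x: "x < N" for x
    proof -
      define c where "c = 1 / (1 + \<gamma> (real x / N))"
      define m where "m = measure_pmf.expectation (p N x) real"
      have \<gamma>x: "0 \<le> \<gamma> (real x / N)" using x by (intro nonneg) auto
      have *: "0 \<le> real x / N" "real x / N \<le> real (x + 1 + k) / N" "real (x + 1 + k) / N \<le> 1"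
        "real (x + 1 + k) / N - real x / N = (1 + real k) / N"
        if "k \<in> set_pmf (p N x)" for k
        using support[OF x] that x by (auto simp: divide_right_mono field_simps)
      have e: "0 \<le> g (x + 1 + k) - g x \<and> g (x + 1 + k) - g x \<le> (1 + real k) / N"
        and lin: "\<bar>g (x + 1 + k) - g x - c * ((1 + real k) / N)\<bar> \<le> L * ((1 + real k) / N)\<^sup>2"
        if "k \<in> set_pmf (p N x)" for k
        using G_bounds[OF *(1,2,3)[OF that]] G_lin[OF *(1,2,3)[OF that]]
        unfolding *(4)[OF that] by (simp_all add: g_def c_def mult.commute)
      \<comment> \<open>The mean of the linear part thus measures the distance of the actual drift
        \<open>m\<close> from \<open>\<gamma> (x / N)\<close>, which is at most
        \<open>\<delta> N\<close>.\<close>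
      have "1 - c * (1 + m) = (\<gamma> (real x / N) - m) / (1 + \<gamma> (real x / N))"
        using \<gamma>x by (simp add: c_def field_simps)
      then have "\<bar>1 - c * (1 + m)\<bar> = \<bar>\<gamma> (real x / N) - m\<bar> / (1 + \<gamma> (real x / N))"
        using \<gamma>x by simp
      also have "\<dots> \<le> \<bar>\<gamma> (real x / N) - m\<bar> / 1"
        using \<gamma>x by (intro divide_left_mono) auto
      also have "\<dots> \<le> \<delta> N"
        using approx'[OF x] by (simp add: drift_def m_def abs_minus_commute)
      finally have "\<bar>1 - c * (1 + m)\<bar> / N \<le> \<delta> N / N" by (intro divide_right_mono) auto
      moreover have "Q x / N\<^sup>2 \<le> S N / N\<^sup>2" using Q[OF x] by (intro divide_right_mono) auto
      moreover from this have "L * (Q x / N\<^sup>2) \<le> L * (S N / N\<^sup>2)" by (intro mult_left_mono L)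
      ultimately show ?thesis
        using potential_increment_moments[OF fin[OF x] N e lin] unfolding a_def b_def m_def Q_def
        by linarith
    qed
    define X where "X \<omega> = real (card {i. i < N \<and> Z N i \<omega> < N}) / N - g N" for \<omega>
    have g01: "0 \<le> g x \<and> g x \<le> 1" if "x \<le> N" for x
      using G_bounds[of 0 "real x / N"] G(1) that N by (auto simp: g_def divide_le_eq_1 intro: order_trans)
    have "g 0 = 0" by (simp add: g_def G(1))
    note L2 = final_active_L2_bound[OF N this g01 moments[THEN conjunct1] moments[THEN conjunct2]]
    have X: "integrable (M N) X" "integrable (M N) (\<lambda>\<omega>. (X \<omega>)\<^sup>2)"
      "expectation (\<lambda>\<omega>. (X \<omega>)\<^sup>2) \<le> N * (2 * a + b)"
      unfolding X_def by (intro L2; assumption)+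
    have "N * (2 * a + b) = \<epsilon> N"
      using N by (simp add: a_def b_def \<epsilon>_def field_simps power2_eq_square)
    then have "expectation (\<lambda>\<omega>. \<bar>X \<omega>\<bar>) \<le> sqrt (\<epsilon> N)"
      using expectation_abs_le_sqrt[OF X(1,2)] X(3) by (auto intro: order_trans)
    \<comment> \<open>Almost surely the hitting time is finite, and
      \<open>g N = G 1 = Tstar\<close>, so the extended real integrand reduces to
      \<open>\<bar>X \<omega>\<bar>\<close>.\<close>
    have "AE \<omega> in M N. e2ennreal
        \<bar>ereal_of_enat (final_active N (Z N) \<omega>) / ereal (real N) - ereal Tstar\<bar> = ennreal \<bar>X \<omega>\<bar>"
      using AE_path
    proof eventually_elim
      case (elim \<omega>)
      have "final_active N (Z N) \<omega> = enat (card {i. i < N \<and> Z N i \<omega> < N})"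
        by (rule final_active_path(1)) (use N elim in auto)
      then show ?case using N G(2) by (simp add: X_def g_def e2ennreal_ereal)
    qed
    then have "(\<integral>\<^sup>+ \<omega>. e2ennreal
        \<bar>ereal_of_enat (final_active N (Z N) \<omega>) / ereal (real N) - ereal Tstar\<bar> \<partial>M N)
        = (\<integral>\<^sup>+ \<omega>. ennreal \<bar>X \<omega>\<bar> \<partial>M N)"
      by (rule nn_integral_cong_AE)
    also have "\<dots> = ennreal (expectation (\<lambda>\<omega>. \<bar>X \<omega>\<bar>))"
      using X(1) by (intro nn_integral_eq_integral) auto
    also have "\<dots> \<le> ennreal (sqrt (\<epsilon> N))" by (rule ennreal_leI) fact
    finally show ?thesis .
  qed
  have "(\<lambda>N. max_dispersion p N / real N) \<longlonglongrightarrow> 0"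
    using smalloD_tendsto[OF dispersion_small] .
  \<comment> \<open>The squared mean stays bounded because \<open>\<delta>\<close> converges, so
    division by \<open>N\<close> removes it.\<close>
  moreover have "(\<lambda>N. (1 + (\<gamma> 0 + L) + \<delta> N)\<^sup>2 * (1 / real N)) \<longlonglongrightarrow> (1 + (\<gamma> 0 + L) + 0)\<^sup>2 * 0"
    by (intro tendsto_intros \<delta>_lim lim_1_over_n)
  ultimately have "(\<lambda>N. max_dispersion p N / real N
      + (1 + (\<gamma> 0 + L) + \<delta> N)\<^sup>2 * (1 / real N)) \<longlonglongrightarrow> 0 + (1 + (\<gamma> 0 + L) + 0)\<^sup>2 * 0"
    by (rule tendsto_add)
  then have "(\<lambda>N. S N / N) \<longlonglongrightarrow> 0"
    by (simp add: S_def add_divide_distrib)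
  then have "\<epsilon> \<longlonglongrightarrow> 2 * 0 + (2 * L + 1) * 0"
    unfolding \<epsilon>_def by (intro tendsto_intros \<delta>_lim)
  then have "(\<lambda>N. ennreal (sqrt (\<epsilon> N))) \<longlonglongrightarrow> ennreal (sqrt 0)"
    by (intro tendsto_ennrealI tendsto_real_sqrt) simp
  then have lim: "(\<lambda>N. ennreal (sqrt (\<epsilon> N))) \<longlonglongrightarrow> 0" by simp
  show ?thesis
    by (rule tendsto_sandwich[OF _ _ tendsto_const lim])
      (simp, rule eventually_sequentiallyI[of 1], rule bound, simp)
qed

end
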